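(* Let $\bar z$ be an optimal solution of [GKC] satisfying $1\ge\bar z_{i1}\ge\dots\ge\bar z_{im}\ge0$ for all $i\in N$, define $\bar a,\bar D,\bar m_i$ and [R-GKC] as in the context, let $z^*$ be an optimal extreme point solution of [R-GKC], and let $k\in N$ be the unique item (if any) with some $z^*_{kj}\in(0,1)$ (all other items have $z^*_{ij}\in\{0,1\}$). Define $\hat z\in\mathbb{R}^{N\times M}$ by $\hat z_{ij}=1$ for $i\in N$, $j\in\{1,\dots,\bar a_i\}$; $\hat z_{ij}=z^*_{ij}$ for $i\in N\setminus\{k\}$, $j\in\{\bar a_i+1,\dots,\bar m_i\}$; and $\hat z_{ij}=0$ otherwise. Then $\hat z$ is an integral feasible solution to [GKC] and $\sum_{i,j}g_{ij}\hat z_{ij}\le2\sum_{i,j}g_{ij}\bar z_{ij}$; thus $\hat z$ is a 2-approximate solution to the Non-Linear Knapsack-Cover problem.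
   Context: Non-Linear Knapsack-Cover problem: given a finite set $N$ of items, a demand $D\in\mathbb{N}$, an integer $m\le D$, and for each $i\in N$ a non-decreasing $f_i:\{0,\dots,m\}\to\mathbb{Q}_{\ge0}\cup\{\infty\}$, choose $x\in\{0,\dots,m\}^N$ with $\sum_i x_i\ge D$ minimizing $\sum_i f_i(x_i)$; the instance is assumed feasible. $M=\{1,\dots,m\}$, $g_{ij}=f_i(j)-f_i(j-1)$; a choice $x$ corresponds to $z\in\{0,1\}^{N\times M}$ with $z_{ij}=1$ iff $x_i\ge j$. For $a\in\{0,\dots,m\}^N$ let $D(a)=\max\{D-\sum_ia_i,0\}$, $m_i(a)=\min\{m,a_i+D(a)\}$. [GKC]: minimize $\sum_{i,j}g_{ij}z_{ij}$ over $z\ge0$ subject to $\sum_{i\in N}\sum_{j=a_i+1}^{m_i(a)}\min\{z_{ij},\dots,z_{i1}\}\ge D(a)$ for all $a\in\{0,\dots,m\}^N$. Given $\bar z$: $\bar a_i=\max\{j\in M:\bar z_{ij}\ge1/2\}$ ($0$ if none), $\bar D=D(\bar a)$, $\bar m_i=m_i(\bar a)$. [R-GKC]: in variables $z_{ij}$, $i\in N$, $\bar a_i<j\le\bar m_i$, minimize $\sum_{i}\sum_{j=\bar a_i+1}^{\bar m_i}g_{ij}z_{ij}$ s.t. $\sum_{i}\sum_{j=\bar a_i+1}^{\bar m_i}z_{ij}\ge2\bar D$ and $1\ge z_{i,\bar a_i+1}\ge\dots\ge z_{i,\bar m_i}\ge0$ for all $i$. *)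

theory Defs
  imports "HOL-Analysis.Analysis" "HOL-Analysis.Finite_Function_Topology"
begin

section \<open>The Non-Linear Knapsack-Cover problem\<close>

definition choices :: "'i set \<Rightarrow> nat \<Rightarrow> ('i \<Rightarrow> nat) set" where
  "choices N m = {x. \<forall>i\<in>N. x i \<le> m}"

definition nlkc_feasible :: "'i set \<Rightarrow> nat \<Rightarrow> nat \<Rightarrow> ('i \<Rightarrow> nat) set" where
  "nlkc_feasible N D m = {x \<in> choices N m. D \<le> (\<Sum>i\<in>N. x i)}"

definition nlkc_cost :: "'i set \<Rightarrow> ('i \<Rightarrow> nat \<Rightarrow> ereal) \<Rightarrow> ('i \<Rightarrow> nat) \<Rightarrow> ereal" where
  "nlkc_cost N f x = (\<Sum>i\<in>N. f i (x i))"

definition nlkc_opt :: "'i set \<Rightarrow> nat \<Rightarrow> nat \<Rightarrow> ('i \<Rightarrow> nat \<Rightarrow> ereal) \<Rightarrow> ereal" where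
  "nlkc_opt N D m f = (INF x \<in> nlkc_feasible N D m. nlkc_cost N f x)"

text \<open>Feasibility only asks for a choice covering the demand, not for one of finite cost.\<close>

definition nlkc_instance :: "'i set \<Rightarrow> nat \<Rightarrow> nat \<Rightarrow> ('i \<Rightarrow> nat \<Rightarrow> ereal) \<Rightarrow> bool" where
  "nlkc_instance N D m f \<longleftrightarrow>
     finite N \<and> m \<le> D \<and>
     (\<forall>i\<in>N. \<forall>j\<le>m. f i j = \<infinity> \<or> (\<exists>q\<in>\<rat>. 0 \<le> q \<and> f i j = ereal q)) \<and>
     (\<forall>i\<in>N. mono_on {0..m} (f i)) \<and>
     nlkc_feasible N D m \<noteq> {}"

text \<open>On \<^typ>\<open>ereal\<close>, \<open>\<infinity> - \<infinity> = \<infinity>\<close> and \<open>\<infinity> * 0 = 0\<close>; so every level \<open>j \<ge> 1\<close> with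
  \<open>f i j = \<infinity>\<close> has increment \<open>\<infinity>\<close>, which is charged only if it is used.\<close>

definition incr :: "('i \<Rightarrow> nat \<Rightarrow> ereal) \<Rightarrow> 'i \<Rightarrow> nat \<Rightarrow> ereal" where
  "incr f i j = f i j - f i (j - 1)"

text \<open>Subtraction on \<^typ>\<open>nat\<close> truncates at \<open>0\<close>, which is the maximum with \<open>0\<close> in \<open>D(a)\<close>.\<close>

definition resid_demand :: "'i set \<Rightarrow> nat \<Rightarrow> ('i \<Rightarrow> nat) \<Rightarrow> nat" where
  "resid_demand N D a = D - (\<Sum>i\<in>N. a i)"

definition resid_cap :: "'i set \<Rightarrow> nat \<Rightarrow> nat \<Rightarrow> ('i \<Rightarrow> nat) \<Rightarrow> 'i \<Rightarrow> nat" where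
  "resid_cap N D m a i = min m (a i + resid_demand N D a)"


section \<open>The relaxation GKC\<close>

text \<open>For a finite index set \<open>I \<subseteq> N \<times> {1..m}\<close>, the space of real vectors indexed by \<open>I\<close> is
  represented by the \<open>z :: ('i \<times> nat) \<Rightarrow>\<^sub>0 real\<close> with \<open>Poly_Mapping.keys z \<subseteq> I\<close>. This type is a real vector
  space, so \<^const>\<open>extreme_point_of\<close> applies.\<close>

definition gkc_feasible :: "'i set \<Rightarrow> nat \<Rightarrow> nat \<Rightarrow> (('i \<times> nat) \<Rightarrow>\<^sub>0 real) set" where
  "gkc_feasible N D m = {z.
     Poly_Mapping.keys z \<subseteq> N \<times> {1..m} \<and>
     (\<forall>i\<in>N. \<forall>j\<in>{1..m}. 0 \<le> Poly_Mapping.lookup z (i, j)) \<and>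
     (\<forall>a\<in>choices N m.
        real (resid_demand N D a) \<le>
        (\<Sum>i\<in>N. \<Sum>j = a i + 1..resid_cap N D m a i. Min ((\<lambda>l. Poly_Mapping.lookup z (i, l)) ` {1..j})))}"

definition gkc_cost ::
    "'i set \<Rightarrow> nat \<Rightarrow> ('i \<Rightarrow> nat \<Rightarrow> ereal) \<Rightarrow> (('i \<times> nat) \<Rightarrow>\<^sub>0 real) \<Rightarrow> ereal" where
  "gkc_cost N m f z = (\<Sum>i\<in>N. \<Sum>j = 1..m. incr f i j * ereal (Poly_Mapping.lookup z (i, j)))"

definition gkc_optimal ::
    "'i set \<Rightarrow> nat \<Rightarrow> nat \<Rightarrow> ('i \<Rightarrow> nat \<Rightarrow> ereal) \<Rightarrow> (('i \<times> nat) \<Rightarrow>\<^sub>0 real) \<Rightarrow> bool" where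
  "gkc_optimal N D m f z \<longleftrightarrow>
     z \<in> gkc_feasible N D m \<and> (\<forall>y\<in>gkc_feasible N D m. gkc_cost N m f z \<le> gkc_cost N m f y)"

text \<open>\<open>unit_chain l u w\<close> is \<open>1 \<ge> w l \<ge> w (l + 1) \<ge> \<dots> \<ge> w u \<ge> 0\<close>.\<close>

definition unit_chain :: "nat \<Rightarrow> nat \<Rightarrow> (nat \<Rightarrow> real) \<Rightarrow> bool" where
  "unit_chain l u w \<longleftrightarrow>
     (\<forall>j\<in>{l..u}. 0 \<le> w j \<and> w j \<le> 1) \<and> (\<forall>j\<in>{l..<u}. w (Suc j) \<le> w j)"


section \<open>The residual problem R-GKC\<close>

definition abar :: "nat \<Rightarrow> (('i \<times> nat) \<Rightarrow>\<^sub>0 real) \<Rightarrow> 'i \<Rightarrow> nat" where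
  "abar m zbar i =
     (if \<exists>j\<in>{1..m}. 1 / 2 \<le> Poly_Mapping.lookup zbar (i, j)
      then Max {j \<in> {1..m}. 1 / 2 \<le> Poly_Mapping.lookup zbar (i, j)} else 0)"

definition Dbar :: "'i set \<Rightarrow> nat \<Rightarrow> nat \<Rightarrow> (('i \<times> nat) \<Rightarrow>\<^sub>0 real) \<Rightarrow> nat" where
  "Dbar N D m zbar = resid_demand N D (abar m zbar)"

definition mbar :: "'i set \<Rightarrow> nat \<Rightarrow> nat \<Rightarrow> (('i \<times> nat) \<Rightarrow>\<^sub>0 real) \<Rightarrow> 'i \<Rightarrow> nat" where
  "mbar N D m zbar = resid_cap N D m (abar m zbar)"

definition rgkc_feasible ::
    "'i set \<Rightarrow> nat \<Rightarrow> nat \<Rightarrow> (('i \<times> nat) \<Rightarrow>\<^sub>0 real) \<Rightarrow> (('i \<times> nat) \<Rightarrow>\<^sub>0 real) set" where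
  "rgkc_feasible N D m zbar = {z.
     Poly_Mapping.keys z \<subseteq> (SIGMA i:N. {abar m zbar i + 1..mbar N D m zbar i}) \<and>
     2 * real (Dbar N D m zbar) \<le>
       (\<Sum>i\<in>N. \<Sum>j = abar m zbar i + 1..mbar N D m zbar i. Poly_Mapping.lookup z (i, j)) \<and>
     (\<forall>i\<in>N. unit_chain (abar m zbar i + 1) (mbar N D m zbar i) (\<lambda>j. Poly_Mapping.lookup z (i, j)))}"

definition rgkc_cost ::
    "'i set \<Rightarrow> nat \<Rightarrow> nat \<Rightarrow> ('i \<Rightarrow> nat \<Rightarrow> ereal) \<Rightarrow> (('i \<times> nat) \<Rightarrow>\<^sub>0 real) \<Rightarrow>
     (('i \<times> nat) \<Rightarrow>\<^sub>0 real) \<Rightarrow> ereal" where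
  "rgkc_cost N D m f zbar z =
     (\<Sum>i\<in>N. \<Sum>j = abar m zbar i + 1..mbar N D m zbar i. incr f i j * ereal (Poly_Mapping.lookup z (i, j)))"

definition rgkc_optimal ::
    "'i set \<Rightarrow> nat \<Rightarrow> nat \<Rightarrow> ('i \<Rightarrow> nat \<Rightarrow> ereal) \<Rightarrow> (('i \<times> nat) \<Rightarrow>\<^sub>0 real) \<Rightarrow>
     (('i \<times> nat) \<Rightarrow>\<^sub>0 real) \<Rightarrow> bool" where
  "rgkc_optimal N D m f zbar z \<longleftrightarrow>
     z \<in> rgkc_feasible N D m zbar \<and>
     (\<forall>y\<in>rgkc_feasible N D m zbar. rgkc_cost N D m f zbar z \<le> rgkc_cost N D m f zbar y)"


section \<open>The rounded solution\<close>

definition fractional_item ::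
    "'i set \<Rightarrow> nat \<Rightarrow> nat \<Rightarrow> (('i \<times> nat) \<Rightarrow>\<^sub>0 real) \<Rightarrow> (('i \<times> nat) \<Rightarrow>\<^sub>0 real) \<Rightarrow> 'i \<Rightarrow> bool" where
  "fractional_item N D m zbar zstar k \<longleftrightarrow>
     k \<in> N \<and>
     (\<exists>j\<in>{abar m zbar k + 1..mbar N D m zbar k}. 0 < Poly_Mapping.lookup zstar (k, j) \<and> Poly_Mapping.lookup zstar (k, j) < 1)"

text \<open>The removed item \<open>k\<close> need not exist, so the definition removes all fractional items;
  that there is at most one is part of the claim about extreme points.\<close>

definition zhat ::
    "'i set \<Rightarrow> nat \<Rightarrow> nat \<Rightarrow> (('i \<times> nat) \<Rightarrow>\<^sub>0 real) \<Rightarrow> (('i \<times> nat) \<Rightarrow>\<^sub>0 real) \<Rightarrow>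
     (('i \<times> nat) \<Rightarrow>\<^sub>0 real)" where
  "zhat N D m zbar zstar = Abs_poly_mapping (\<lambda>(i, j).
     if i \<in> N \<and> j \<in> {1..abar m zbar i} then 1
     else if i \<in> N - {k. fractional_item N D m zbar zstar k} \<and>
             j \<in> {abar m zbar i + 1..mbar N D m zbar i} then Poly_Mapping.lookup zstar (i, j)
     else 0)"

lemma lookup_zhat:
  assumes "finite N"
  shows "Poly_Mapping.lookup (zhat N D m zbar zstar) (i, j) =
    (if i \<in> N \<and> j \<in> {1..abar m zbar i} then 1
     else if i \<in> N - {k. fractional_item N D m zbar zstar k} \<and>
             j \<in> {abar m zbar i + 1..mbar N D m zbar i} then Poly_Mapping.lookup zstar (i, j)
     else 0)"
proof -
  let ?h = "\<lambda>(i, j). if i \<in> N \<and> j \<in> {1..abar m zbar i} then 1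
     else if i \<in> N - {k. fractional_item N D m zbar zstar k} \<and>
             j \<in> {abar m zbar i + 1..mbar N D m zbar i} then Poly_Mapping.lookup zstar (i, j)
     else (0::real)"
  have "{p. ?h p \<noteq> 0} \<subseteq> (SIGMA i:N. {1..abar m zbar i}) \<union> Poly_Mapping.keys zstar"
    by (auto simp: in_keys_iff split: if_splits)
  moreover have "finite ((SIGMA i:N. {1..abar m zbar i}) \<union> Poly_Mapping.keys zstar)"
    using assms by auto
  ultimately have "finite {p. ?h p \<noteq> 0}"
    by (rule finite_subset)
  then show ?thesis
    by (simp add: zhat_def lookup_Abs_poly_mapping)
qed

definition corresponds ::
    "'i set \<Rightarrow> nat \<Rightarrow> ('i \<Rightarrow> nat) \<Rightarrow> (('i \<times> nat) \<Rightarrow>\<^sub>0 real) \<Rightarrow> bool" where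
  "corresponds N m x z \<longleftrightarrow>
     Poly_Mapping.keys z \<subseteq> N \<times> {1..m} \<and>
     (\<forall>i\<in>N. \<forall>j\<in>{1..m}. Poly_Mapping.lookup z (i, j) = (if j \<le> x i then 1 else 0))"

definition approx_solution ::
    "ereal \<Rightarrow> 'i set \<Rightarrow> nat \<Rightarrow> nat \<Rightarrow> ('i \<Rightarrow> nat \<Rightarrow> ereal) \<Rightarrow> (('i \<times> nat) \<Rightarrow>\<^sub>0 real) \<Rightarrow> bool" where
  "approx_solution \<alpha> N D m f z \<longleftrightarrow>
     (\<exists>x\<in>nlkc_feasible N D m. corresponds N m x z \<and> nlkc_cost N f x \<le> \<alpha> * nlkc_opt N D m f)"

end

theory Submission
  imports Defs
begin

text \<open>An extreme point of R-GKC has at most one fractional item, since two of them could trade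
  mass against each other. Dropping that item loses at most \<open>mbar k - abar k \<le> Dbar\<close> of the covered
  demand \<open>2 * Dbar\<close>, so what is left, together with \<open>abar\<close>, still covers \<open>D\<close>; and a 0/1 chain
  covering \<open>D\<close> satisfies every knapsack-cover inequality. For the cost, \<open>2 * zbar\<close> is at least \<open>1\<close>
  below \<open>abar\<close>, and above \<open>abar\<close> it is feasible for R-GKC by the knapsack-cover inequality for
  \<open>a = abar\<close>, so it pays for \<open>zstar\<close>.\<close>

section \<open>Extreme points and monotone chains in the unit interval\<close>

text \<open>Otherwise \<open>x\<close> would be the midpoint of the nondegenerate segment from
  \<open>x - d\<close> to \<open>x + d\<close> inside \<open>S\<close>.\<close>

lemma extreme_point_perturbation_zero:
  fixes x d :: "'a::real_vector"
  assumes "x extreme_point_of S" "x + d \<in> S" "x - d \<in> S"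
  shows "d = 0"
proof (rule ccontr)
  assume "d \<noteq> 0"
  have "x - d \<noteq> x + d"
  proof
    assume "x - d = x + d"
    then have "2 *\<^sub>R d = 0"
      by (simp add: scaleR_2 neg_eq_iff_add_eq_0 flip: uminus_add_conv_diff)
    with \<open>d \<noteq> 0\<close> show False by simp
  qed
  moreover have "x = (1 - 1/2) *\<^sub>R (x - d) + (1/2) *\<^sub>R (x + d)"
    by (simp add: scaleR_add_right scaleR_diff_right flip: scaleR_add_left)
  ultimately have "x \<in> open_segment (x - d) (x + d)"
    unfolding in_segment by (intro conjI exI[of _ "1/2::real"]) auto
  with assms show False
    unfolding extreme_point_of_def by blast
qed

lemma unit_chain_antimono:
  assumes "unit_chain l u w" "l \<le> i" "i \<le> j" "j \<le> u"
  shows "w j \<le> w i"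
  using assms(3,4)
proof (induction j rule: dec_induct)
  case (step n)
  then have "w (Suc n) \<le> w n"
    using assms(1,2) by (auto simp: unit_chain_def)
  with step show ?case by simp
qed simp

text \<open>The map \<open>t \<mapsto> t + s t (1 - t)\<close> is a monotone self-map of the unit interval whenever \<open>\<bar>s\<bar> \<le> 1\<close>.
  It moves exactly the fractional entries, so a chain need not be decomposed into blocks of
  equal values to perturb it.\<close>

lemma unit_chain_perturb:
  assumes "unit_chain l u w" "\<bar>s\<bar> \<le> 1"
  shows "unit_chain l u (\<lambda>j. w j + s * (w j * (1 - w j)))"
proof -
  have mono: "t + s * (t * (1 - t)) \<le> t' + s * (t' * (1 - t'))"
    if "0 \<le> t" "t \<le> t'" "t' \<le> 1" for t t' :: real
  proof -
    have "\<bar>s * (1 - t - t')\<bar> \<le> 1 * 1"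
      unfolding abs_mult using assms(2) that by (intro mult_mono) auto
    \<comment> \<open>This product is the difference of the two sides of the claim.\<close>
    then have "0 \<le> (t' - t) * (1 + s * (1 - t - t'))"
      using that by (intro mult_nonneg_nonneg) auto
    then show ?thesis by (simp add: algebra_simps)
  qed
  \<comment> \<open>The map fixes 0 and 1, so the bounds are monotonicity against these two
    points.\<close>
  have "0 \<le> w j + s * (w j * (1 - w j)) \<and> w j + s * (w j * (1 - w j)) \<le> 1" if "j \<in> {l..u}" for j
    using mono[of 0 "w j"] mono[of "w j" 1] that assms(1) by (auto simp: unit_chain_def)
  moreover have "w (Suc j) + s * (w (Suc j) * (1 - w (Suc j))) \<le> w j + s * (w j * (1 - w j))"
    if "j \<in> {l..<u}" for j
    using that assms(1) by (intro mono) (auto simp: unit_chain_def)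
  ultimately show ?thesis by (simp add: unit_chain_def)
qed

text \<open>If the last entry is 1, the chain is 1 throughout; if it is 0, the threshold of the
  shorter chain still works. This turns a rounded vector back into a choice.\<close>

lemma integral_unit_chain_threshold:
  assumes "unit_chain 1 m w" "\<And>j. j \<in> {1..m} \<Longrightarrow> w j \<in> {0, 1}"
  shows "\<exists>x\<le>m. \<forall>j\<in>{1..m}. w j = (if j \<le> x then 1 else 0)"
  using assms
proof (induction m)
  case (Suc m)
  show ?case
  proof (cases "w (Suc m) = 1")
    case True
    have "w j = 1" if "j \<in> {1..Suc m}" for j
      using unit_chain_antimono[OF Suc.prems(1), of j "Suc m"] that True Suc.prems(2)[of j] by auto
    then show ?thesis by (intro exI[of _ "Suc m"]) auto
  next
    case False
    have "unit_chain 1 m w"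
      using Suc.prems(1) by (auto simp: unit_chain_def)
    then obtain x where "x \<le> m" "\<forall>j\<in>{1..m}. w j = (if j \<le> x then 1 else 0)"
      using Suc.IH Suc.prems(2) by (metis atLeastAtMost_iff le_SucI)
    moreover have "w (Suc m) = 0"
      using False Suc.prems(2)[of "Suc m"] by auto
    ultimately show ?thesis
      by (intro exI[of _ x]) (auto simp: le_Suc_eq)
  qed
qed simp

text \<open>Truncated subtraction covers the cases \<open>x \<le> a\<close> and
  \<open>c \<le> a\<close>, where both sides are 0.\<close>

lemma sum_threshold:
  "(\<Sum>j = Suc a..c. if j \<le> x then 1 else 0 :: real) = real (min x c - a)"
proof -
  have "{Suc a..c} \<inter> {j. j \<le> x} = {Suc a..min x c}" by auto
  then show ?thesis by (simp add: sum.If_cases)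
qed

section \<open>Item costs and their increments\<close>

lemma item_cost_nonneg:
  assumes "nlkc_instance N D m f" "i \<in> N" "j \<le> m"
  shows "0 \<le> f i j"
proof -
  have "f i j = \<infinity> \<or> (\<exists>q\<in>\<rat>. 0 \<le> q \<and> f i j = ereal q)"
    using assms by (simp add: nlkc_instance_def)
  then show ?thesis by auto
qed

lemma item_cost_mono:
  assumes "nlkc_instance N D m f" "i \<in> N" "j \<le> l" "l \<le> m"
  shows "f i j \<le> f i l"
proof -
  have "mono_on {0..m} (f i)"
    using assms by (simp add: nlkc_instance_def)
  then show ?thesis
    by (rule mono_onD) (use assms(3,4) in auto)
qed

lemma incr_nonneg:
  assumes "nlkc_instance N D m f" "i \<in> N" "j \<in> {1..m}"
  shows "0 \<le> incr f i j"
proof -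
  have "f i (j - 1) \<le> f i j"
    using assms(3) by (intro item_cost_mono[OF assms(1,2)]) auto
  moreover have "0 \<le> f i (j - 1)"
    using assms(3) by (intro item_cost_nonneg[OF assms(1,2)]) auto
  ultimately show ?thesis
    by (cases "f i j"; cases "f i (j - 1)") (auto simp: incr_def)
qed

text \<open>Telescoping survives infinite costs: by monotonicity, once \<open>f i x\<close> is
  \<open>\<infinity>\<close> the next value is \<open>\<infinity>\<close> too, so no finite value
  has to be recovered from \<open>\<infinity>\<close>.\<close>

lemma sum_incr:
  assumes inst: "nlkc_instance N D m f" and "i \<in> N" "x \<le> m"
  shows "f i 0 + (\<Sum>j = 1..x. incr f i j) = f i x"
  using assms(3)
proof (induction x)
  case (Suc x)
  have mono: "f i x \<le> f i (Suc x)" and nonneg: "0 \<le> f i x"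
    using Suc.prems by (auto intro: item_cost_mono[OF assms(1,2)] item_cost_nonneg[OF assms(1,2)])
  have "f i 0 + (\<Sum>j = 1..Suc x. incr f i j) = (f i 0 + (\<Sum>j = 1..x. incr f i j)) + incr f i (Suc x)"
    by (simp add: add.assoc)
  also have "\<dots> = f i x + (f i (Suc x) - f i x)"
    using Suc by (simp add: incr_def)
  also have "\<dots> = f i (Suc x)"
    using mono nonneg by (cases "f i x"; cases "f i (Suc x)") auto
  finally show ?case .
qed simp

section \<open>Choices as 0/1 vectors\<close>

lemma corresponds_exists:
  assumes "finite N"
  shows "\<exists>z. corresponds N m x z"
proof -
  let ?h = "\<lambda>(i, j). if i \<in> N \<and> j \<in> {1..m} \<and> j \<le> x i then 1 else 0 :: real"
  have sub: "{p. ?h p \<noteq> 0} \<subseteq> N \<times> {1..m}" by (auto split: if_splits)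
  then have "finite {p. ?h p \<noteq> 0}"
    using assms finite_subset by blast
  then have eq: "Poly_Mapping.lookup (Abs_poly_mapping ?h) = ?h"
    by (simp add: lookup_Abs_poly_mapping)
  have "corresponds N m x (Abs_poly_mapping ?h)"
    unfolding corresponds_def eq keys.rep_eq using sub by simp
  then show ?thesis ..
qed

text \<open>Fix \<open>a\<close>. Either one item exceeds \<open>a i\<close> by at least the
  residual demand and covers it alone, or the cap \<open>resid_cap\<close> cuts off nothing of
  \<open>x\<close> and the inequality follows from \<open>x\<close> covering
  \<open>D\<close>.\<close>

lemma corresponds_gkc_feasible:
  assumes "finite N" "x \<in> nlkc_feasible N D m" "corresponds N m x z"
  shows "z \<in> gkc_feasible N D m"
proof -
  have z: "Poly_Mapping.lookup z (i, j) = (if j \<le> x i then 1 else 0)" if "i \<in> N" "j \<in> {1..m}" for i j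
    using assms(3) that by (simp add: corresponds_def)
  have xm: "x i \<le> m" if "i \<in> N" for i
    using assms(2) that by (simp add: nlkc_feasible_def choices_def)
  have xD: "D \<le> (\<Sum>i\<in>N. x i)"
    using assms(2) by (simp add: nlkc_feasible_def)
  have "real (resid_demand N D a) \<le>
      (\<Sum>i\<in>N. \<Sum>j = a i + 1..resid_cap N D m a i. Min ((\<lambda>l. Poly_Mapping.lookup z (i, l)) ` {1..j}))" for a
  proof -
    let ?cover = "\<lambda>i. min (x i) (resid_cap N D m a i) - a i"
    have "resid_demand N D a \<le> (\<Sum>i\<in>N. ?cover i)"
    proof (cases "\<exists>i\<in>N. a i + resid_demand N D a \<le> x i")
      case True
      then obtain i where i: "i \<in> N" "a i + resid_demand N D a \<le> x i" by blast
      then have "resid_demand N D a = ?cover i"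
        using xm[of i] by (simp add: resid_cap_def)
      also have "\<dots> \<le> (\<Sum>i\<in>N. ?cover i)"
        using assms(1) i by (intro member_le_sum) auto
      finally show ?thesis .
    next
      case False
      then have "?cover i = x i - a i" if "i \<in> N" for i
        using that xm[of i] by (force simp: resid_cap_def min_def)
      \<comment> \<open>Items with \<open>x i < a i\<close> do no harm, since truncated subtraction
        gives them cover 0.\<close>
      then have "(\<Sum>i\<in>N. x i) \<le> (\<Sum>i\<in>N. a i + ?cover i)"
        by (intro sum_mono) simp
      then show ?thesis
        using xD by (simp add: sum.distrib resid_demand_def)
    qed
    then have "real (resid_demand N D a) \<le> (\<Sum>i\<in>N. real (?cover i))"
      by (simp flip: of_nat_sum)
    also have "\<dots> = (\<Sum>i\<in>N. \<Sum>j = a i + 1..resid_cap N D m a i. if j \<le> x i then 1 else 0)"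
      by (simp add: sum_threshold)
    also have "\<dots> \<le> (\<Sum>i\<in>N. \<Sum>j = a i + 1..resid_cap N D m a i.
        Min ((\<lambda>l. Poly_Mapping.lookup z (i, l)) ` {1..j}))"
    proof (intro sum_mono)
      fix i j assume "i \<in> N" and j: "j \<in> {a i + 1..resid_cap N D m a i}"
      then have "(if j \<le> x i then 1 else 0) \<le> Poly_Mapping.lookup z (i, l)" if "l \<in> {1..j}" for l
        using z[of i l] that by (auto simp: resid_cap_def)
      with j show "(if j \<le> x i then 1 else 0) \<le> Min ((\<lambda>l. Poly_Mapping.lookup z (i, l)) ` {1..j})"
        by (subst Min_ge_iff) auto
    qed
    finally show ?thesis .
  qed
  then show ?thesis
    using assms(3) z unfolding gkc_feasible_def corresponds_def by auto
qed

text \<open>The objective of [GKC] charges increments only, so the two objectives differ by the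
  constant cost of level 0.\<close>

lemma corresponds_cost:
  assumes inst: "nlkc_instance N D m f" and "x \<in> choices N m" "corresponds N m x z"
  shows "nlkc_cost N f x = (\<Sum>i\<in>N. f i 0) + gkc_cost N m f z"
proof -
  have "f i (x i) = f i 0 + (\<Sum>j = 1..m. incr f i j * ereal (Poly_Mapping.lookup z (i, j)))"
    if "i \<in> N" for i
  proof -
    have xm: "x i \<le> m"
      using assms(2) that by (simp add: choices_def)
    \<comment> \<open>Levels above \<open>x i\<close> contribute 0 even if their increment is
      \<open>\<infinity>\<close>, because \<open>\<infinity> * 0 = 0\<close> on
      \<open>ereal\<close>.\<close>
    have "(\<Sum>j = 1..m. incr f i j * ereal (Poly_Mapping.lookup z (i, j))) =
        (\<Sum>j = 1..m. if j \<in> {1..x i} then incr f i j else 0)"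
      using assms(3) that by (intro sum.cong)
        (auto simp: corresponds_def simp flip: one_ereal_def zero_ereal_def)
    also have "\<dots> = (\<Sum>j = 1..x i. incr f i j)"
      using xm by (subst sum.inter_restrict[symmetric]) (auto intro: arg_cong2[where f = sum])
    finally show ?thesis
      using sum_incr[OF inst that xm] by simp
  qed
  then show ?thesis
    by (simp add: nlkc_cost_def gkc_cost_def sum.distrib)
qed

section \<open>Thresholding \<open>zbar\<close> at one half\<close>

lemma abar_le: "abar m zbar i \<le> m"
  unfolding abar_def by (auto intro!: Max.boundedI)

lemma mbar_le: "mbar N D m zbar i \<le> m"
  by (simp add: mbar_def resid_cap_def)

text \<open>Bounds the number of residual levels of one item, hence the mass lost when that item is
  dropped.\<close>

lemma mbar_le_abar_plus_Dbar: "mbar N D m zbar i \<le> abar m zbar i + Dbar N D m zbar"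
  by (simp add: mbar_def Dbar_def resid_cap_def)

lemma half_le_below_abar:
  assumes "unit_chain 1 m (\<lambda>j. Poly_Mapping.lookup zbar (i, j))" "j \<in> {1..abar m zbar i}"
  shows "1 / 2 \<le> Poly_Mapping.lookup zbar (i, j)"
proof -
  let ?J = "{j \<in> {1..m}. 1 / 2 \<le> Poly_Mapping.lookup zbar (i, j)}"
  \<comment> \<open>Some \<open>j\<close> lies in \<open>{1..abar m zbar i}\<close>, so
    \<open>abar\<close> is not its default value 0 here.\<close>
  have ex: "\<exists>j\<in>{1..m}. 1 / 2 \<le> Poly_Mapping.lookup zbar (i, j)"
    using assms(2) by (auto simp: abar_def split: if_splits)
  then have "abar m zbar i = Max ?J"
    by (simp add: abar_def)
  moreover have "Max ?J \<in> ?J"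
    using ex by (intro Max_in) auto
  ultimately have "1 / 2 \<le> Poly_Mapping.lookup zbar (i, abar m zbar i)" by simp
  also have "\<dots> \<le> Poly_Mapping.lookup zbar (i, j)"
    using assms(2) abar_le by (intro unit_chain_antimono[OF assms(1)]) auto
  finally show ?thesis .
qed

lemma less_half_above_abar:
  assumes "abar m zbar i < j" "j \<le> m"
  shows "Poly_Mapping.lookup zbar (i, j) < 1 / 2"
proof (rule ccontr)
  assume "\<not> ?thesis"
  then have *: "j \<in> {j \<in> {1..m}. 1 / 2 \<le> Poly_Mapping.lookup zbar (i, j)}"
    using assms by auto
  then have "j \<le> abar m zbar i"
    unfolding abar_def by (auto intro: Max_ge)
  with assms show False by simp
qed

section \<open>Extreme points of [R-GKC]\<close>

text \<open>With two fractional items, the fractional entries of one can be raised and those of the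
  other lowered so that the covering sum is unchanged. The opposite move is feasible too, which
  contradicts extremality.\<close>

lemma fractional_item_unique:
  assumes fin: "finite N" and ext: "zstar extreme_point_of rgkc_feasible N D m zbar"
    and k: "fractional_item N D m zbar zstar k" and l: "fractional_item N D m zbar zstar l"
  shows "k = l"
proof (rule ccontr)
  assume "k \<noteq> l"
  let ?R = "\<lambda>i. {abar m zbar i + 1..mbar N D m zbar i}"
  let ?z = "\<lambda>i j. Poly_Mapping.lookup zstar (i, j)"
  let ?q = "\<lambda>i j. ?z i j * (1 - ?z i j)"
  define S where "S i = (\<Sum>j\<in>?R i. ?q i j)" for i
  \<comment> \<open>\<open>S i\<close> is the rate at which the mass of item \<open>i\<close>
    changes. The weights make \<open>s k * S k + s l * S l\<close> vanish and are scaled to absolute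
    value at most 1, as \<open>unit_chain_perturb\<close> requires.\<close>
  define s where "s i = (if i = k then S l / (S k + S l) else if i = l then - S k / (S k + S l) else 0)" for i
  define d where "d = Abs_poly_mapping (\<lambda>(i, j). s i * ?q i j)"
  have feas: "zstar \<in> rgkc_feasible N D m zbar"
    using ext by (simp add: extreme_point_of_def)
  have kN: "k \<in> N" "l \<in> N"
    using k l by (auto simp: fractional_item_def)
  have chain: "unit_chain (abar m zbar i + 1) (mbar N D m zbar i) (?z i)" if "i \<in> N" for i
    using feas that by (simp add: rgkc_feasible_def)
  have q_nonneg: "0 \<le> ?q i j" if "i \<in> N" "j \<in> ?R i" for i j
    using chain[OF that(1)] that(2) by (auto simp: unit_chain_def)
  have S_pos: "0 < S i" if frac: "fractional_item N D m zbar zstar i" for i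
  proof -
    obtain j where j: "i \<in> N" "j \<in> ?R i" "0 < ?q i j"
      using frac by (auto simp: fractional_item_def)
    then show ?thesis
      unfolding S_def using q_nonneg by (intro sum_pos2[of _ j]) auto
  qed
  note S_pos_kl = S_pos[OF k] S_pos[OF l]
  have s_bound: "\<bar>s i\<bar> \<le> 1" for i
    using S_pos_kl by (auto simp: s_def)
  have s_sum: "(\<Sum>i\<in>N. s i * S i) = 0"
  proof -
    have "(\<Sum>i\<in>N. s i * S i) = (\<Sum>i\<in>{k, l}. s i * S i)"
      using kN fin by (intro sum.mono_neutral_right) (auto simp: s_def)
    also have "\<dots> = 0"
      using \<open>k \<noteq> l\<close> by (simp add: s_def)
    finally show ?thesis .
  qed
  \<comment> \<open>The factor \<open>?q i j\<close> vanishes wherever \<open>zstar\<close> does, so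
    the perturbation has finite support.\<close>
  have "{p. (\<lambda>(i, j). s i * ?q i j) p \<noteq> 0} \<subseteq> Poly_Mapping.keys zstar"
    by (auto simp: in_keys_iff)
  then have lookup_d: "Poly_Mapping.lookup d (i, j) = s i * ?q i j" for i j
    unfolding d_def using finite_subset[OF _ finite_keys] by (subst lookup_Abs_poly_mapping) auto
  \<comment> \<open>The sign \<open>c\<close> treats \<open>zstar + d\<close> and
    \<open>zstar - d\<close> together.\<close>
  have feas_perturb: "z \<in> rgkc_feasible N D m zbar"
    if "\<bar>c\<bar> = 1" and z: "\<And>i j. Poly_Mapping.lookup z (i, j) = ?z i j + c * s i * ?q i j" for c z
  proof -
    have "Poly_Mapping.keys z \<subseteq> Poly_Mapping.keys zstar"
      by (auto simp: in_keys_iff z)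
    moreover have "(\<Sum>i\<in>N. \<Sum>j\<in>?R i. Poly_Mapping.lookup z (i, j)) =
        (\<Sum>i\<in>N. \<Sum>j\<in>?R i. ?z i j) + c * (\<Sum>i\<in>N. s i * S i)"
      unfolding z S_def by (simp add: sum.distrib sum_distrib_left mult.assoc)
    moreover have "unit_chain (abar m zbar i + 1) (mbar N D m zbar i) (\<lambda>j. Poly_Mapping.lookup z (i, j))"
      if "i \<in> N" for i
      unfolding z using \<open>\<bar>c\<bar> = 1\<close> s_bound[of i]
      by (intro unit_chain_perturb chain that) (simp add: abs_mult)
    ultimately show ?thesis
      using feas s_sum unfolding rgkc_feasible_def by auto
  qed
  have "zstar + d \<in> rgkc_feasible N D m zbar"
    by (rule feas_perturb[of 1]) (auto simp: lookup_add lookup_d)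
  moreover have "zstar - d \<in> rgkc_feasible N D m zbar"
    by (rule feas_perturb[of "-1"]) (auto simp: lookup_minus lookup_d)
  ultimately have "d = 0"
    using ext extreme_point_perturbation_zero by blast
  moreover obtain j where "0 < ?z k j" "?z k j < 1"
    using k by (auto simp: fractional_item_def)
  then have "0 < Poly_Mapping.lookup d (k, j)"
    using S_pos_kl by (simp add: lookup_d s_def)
  ultimately show False by simp
qed

section \<open>Rounding to an integral cover\<close>

lemma zhat_corresponds_feasible:
  assumes fin: "finite N" and ext: "zstar extreme_point_of rgkc_feasible N D m zbar"
  shows "\<exists>x\<in>nlkc_feasible N D m. corresponds N m x (zhat N D m zbar zstar)"
proof -
  let ?a = "abar m zbar" and ?u = "mbar N D m zbar" and ?F = "{k. fractional_item N D m zbar zstar k}"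
  let ?R = "\<lambda>i. {?a i + 1..?u i}"
  let ?z = "\<lambda>i j. Poly_Mapping.lookup zstar (i, j)"
  let ?w = "\<lambda>i j. Poly_Mapping.lookup (zhat N D m zbar zstar) (i, j)"
  note lookup = lookup_zhat[OF fin, of D m zbar zstar]
  have feas: "zstar \<in> rgkc_feasible N D m zbar"
    using ext by (simp add: extreme_point_of_def)
  have chain: "unit_chain (?a i + 1) (?u i) (?z i)" if "i \<in> N" for i
    using feas that by (simp add: rgkc_feasible_def)
  have bin: "?z i j \<in> {0, 1}" if "i \<in> N - ?F" "j \<in> ?R i" for i j
    using chain[of i] that by (force simp: unit_chain_def fractional_item_def)
  have w01: "?w i j \<in> {0, 1}" for i j
    unfolding lookup using bin by auto
  \<comment> \<open>For an item of \<open>N\<close>, a block of ones up to \<open>abar\<close> is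
    followed by the residual chain of \<open>zstar\<close>, or by zeros if the item is fractional,
    and then by zeros.\<close>
  have w_chain: "unit_chain 1 m (?w i)" for i
  proof -
    have "?w i (Suc j) \<le> ?w i j" if "j \<in> {1..<m}" for j
      using that w01[of i j] w01[of i "Suc j"] chain[of i]
      unfolding lookup by (force simp: unit_chain_def)
    moreover have "0 \<le> ?w i j \<and> ?w i j \<le> 1" for j
      using w01[of i j] by auto
    ultimately show ?thesis by (simp add: unit_chain_def)
  qed
  have "\<forall>i. \<exists>x\<le>m. \<forall>j\<in>{1..m}. ?w i j = (if j \<le> x then 1 else 0)"
    using integral_unit_chain_threshold[OF w_chain w01] by blast
  then obtain x where x: "\<And>i. x i \<le> m" "\<And>i j. j \<in> {1..m} \<Longrightarrow> ?w i j = (if j \<le> x i then 1 else 0)"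
    by metis
  \<comment> \<open>The mass of row \<open>i\<close> of \<open>zhat\<close> is computed twice: from
    the threshold \<open>x i\<close>, and block by block.\<close>
  have x_eq: "real (x i) = real (?a i) + (if i \<in> ?F then 0 else \<Sum>j\<in>?R i. ?z i j)" if "i \<in> N" for i
  proof -
    have "(\<Sum>j = 1..m. ?w i j) = (\<Sum>j = Suc 0..m. if j \<le> x i then 1 else 0)"
      using x(2) by (intro sum.cong) auto
    also have "\<dots> = real (x i)"
      unfolding sum_threshold using x(1)[of i] by simp
    finally have "real (x i) = (\<Sum>j = 1..m. ?w i j)" ..
    also have "\<dots> = (\<Sum>j\<in>{1..?a i} \<union> ?R i. ?w i j)"
      using abar_le[of m zbar i] mbar_le[of N D m zbar i]
      by (intro sum.mono_neutral_right) (auto simp: lookup)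
    also have "\<dots> = (\<Sum>j = 1..?a i. ?w i j) + (\<Sum>j\<in>?R i. ?w i j)"
      by (intro sum.union_disjoint) auto
    also have "(\<Sum>j = 1..?a i. ?w i j) = real (?a i)"
      using that by (simp add: lookup)
    also have "(\<Sum>j\<in>?R i. ?w i j) = (if i \<in> ?F then 0 else \<Sum>j\<in>?R i. ?z i j)"
      using that by (auto simp: lookup intro!: sum.cong)
    finally show ?thesis .
  qed
  \<comment> \<open>At most one item is dropped, and each of its at most \<open>Dbar\<close>
    residual entries is at most 1.\<close>
  have loss: "(\<Sum>i\<in>N \<inter> ?F. \<Sum>j\<in>?R i. ?z i j) \<le> real (Dbar N D m zbar)"
  proof (cases "N \<inter> ?F = {}")
    case False
    then obtain k where k: "k \<in> N" "k \<in> ?F" by blast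
    then have "N \<inter> ?F = {k}"
      using fractional_item_unique[OF fin ext] by blast
    then have "(\<Sum>i\<in>N \<inter> ?F. \<Sum>j\<in>?R i. ?z i j) = (\<Sum>j\<in>?R k. ?z k j)" by simp
    also have "\<dots> \<le> (\<Sum>j\<in>?R k. 1)"
      using chain[OF k(1)] by (intro sum_mono) (auto simp: unit_chain_def)
    also have "\<dots> \<le> real (Dbar N D m zbar)"
      using mbar_le_abar_plus_Dbar[of N D m zbar k] by simp
    finally show ?thesis .
  qed simp
  have "2 * real (Dbar N D m zbar) \<le> (\<Sum>i\<in>N. \<Sum>j\<in>?R i. ?z i j)"
    using feas by (simp add: rgkc_feasible_def)
  also have "\<dots> = (\<Sum>i\<in>N \<inter> ?F. \<Sum>j\<in>?R i. ?z i j) + (\<Sum>i\<in>N - ?F. \<Sum>j\<in>?R i. ?z i j)"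
    using sum.Int_Diff[OF fin] by blast
  finally have kept: "real (Dbar N D m zbar) \<le> (\<Sum>i\<in>N - ?F. \<Sum>j\<in>?R i. ?z i j)"
    using loss by linarith
  \<comment> \<open>This is an inequality because \<open>Dbar\<close> is truncated at 0 when
    \<open>abar\<close> alone exceeds \<open>D\<close>.\<close>
  have "real D \<le> (\<Sum>i\<in>N. real (?a i)) + real (Dbar N D m zbar)"
    unfolding Dbar_def resid_demand_def by (simp flip: of_nat_sum of_nat_add)
  also have "\<dots> \<le> (\<Sum>i\<in>N. real (?a i)) + (\<Sum>i\<in>N. if i \<in> ?F then 0 else \<Sum>j\<in>?R i. ?z i j)"
    using kept fin by (simp add: sum.If_cases Diff_eq)
  also have "\<dots> = (\<Sum>i\<in>N. real (x i))"
    by (simp add: x_eq sum.distrib)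
  finally have "D \<le> (\<Sum>i\<in>N. x i)"
    by (simp flip: of_nat_sum)
  then have "x \<in> nlkc_feasible N D m"
    using x(1) by (simp add: nlkc_feasible_def choices_def)
  moreover have "corresponds N m x (zhat N D m zbar zstar)"
  proof -
    have "i \<in> N \<and> j \<in> {1..m}" if "?w i j \<noteq> 0" for i j
      using that abar_le[of m zbar i] mbar_le[of N D m zbar i] by (auto simp: lookup split: if_splits)
    then have "Poly_Mapping.keys (zhat N D m zbar zstar) \<subseteq> N \<times> {1..m}"
      by (intro subrelI) (simp add: in_keys_iff)
    then show ?thesis
      by (simp add: corresponds_def x(2))
  qed
  ultimately show ?thesis by blast
qed

section \<open>Cost of the rounded solution\<close>

text \<open>In the knapsack-cover inequality for \<open>a = abar\<close>, each prefix minimum is at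
  most its last entry, so doubling reaches \<open>2 * Dbar\<close>. Entries above
  \<open>abar\<close> are below 1/2, so doubling keeps them at most 1.\<close>

lemma double_residual_feasible:
  assumes fin: "finite N" and feas: "zbar \<in> gkc_feasible N D m"
    and chain: "\<forall>i\<in>N. unit_chain 1 m (\<lambda>j. Poly_Mapping.lookup zbar (i, j))"
  shows "\<exists>y\<in>rgkc_feasible N D m zbar.
    \<forall>i\<in>N. \<forall>j\<in>{abar m zbar i + 1..mbar N D m zbar i}.
      Poly_Mapping.lookup y (i, j) = 2 * Poly_Mapping.lookup zbar (i, j)"
proof -
  let ?a = "abar m zbar" and ?u = "mbar N D m zbar"
  let ?R = "\<lambda>i. {?a i + 1..?u i}"
  let ?h = "\<lambda>(i, j). if i \<in> N \<and> j \<in> ?R i then 2 * Poly_Mapping.lookup zbar (i, j) else 0"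
  define y where "y = Abs_poly_mapping ?h"
  have "{p. ?h p \<noteq> 0} \<subseteq> Poly_Mapping.keys zbar"
    by (auto simp: in_keys_iff split: if_splits)
  then have lookup_y: "Poly_Mapping.lookup y = ?h"
    unfolding y_def using finite_subset[OF _ finite_keys] by (subst lookup_Abs_poly_mapping) auto
  have "real (Dbar N D m zbar) \<le>
      (\<Sum>i\<in>N. \<Sum>j\<in>?R i. Min ((\<lambda>l. Poly_Mapping.lookup zbar (i, l)) ` {1..j}))"
  proof -
    have "?a \<in> choices N m"
      by (simp add: choices_def abar_le)
    then show ?thesis
      using feas unfolding gkc_feasible_def Dbar_def mbar_def by blast
  qed
  also have "\<dots> \<le> (\<Sum>i\<in>N. \<Sum>j\<in>?R i. Poly_Mapping.lookup zbar (i, j))"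
    by (intro sum_mono Min_le) auto
  finally have "2 * real (Dbar N D m zbar) \<le> (\<Sum>i\<in>N. \<Sum>j\<in>?R i. Poly_Mapping.lookup y (i, j))"
    by (simp add: lookup_y flip: sum_distrib_left)
  moreover have "unit_chain (?a i + 1) (?u i) (\<lambda>j. Poly_Mapping.lookup y (i, j))" if "i \<in> N" for i
  proof -
    have "2 * Poly_Mapping.lookup zbar (i, j) \<le> 1" if "j \<in> ?R i" for j
      using less_half_above_abar[of m zbar i j] mbar_le[of N D m zbar i] that by auto
    moreover have "unit_chain 1 m (\<lambda>j. Poly_Mapping.lookup zbar (i, j))"
      using chain that by blast
    ultimately show ?thesis
      using that mbar_le[of N D m zbar i] by (auto simp: unit_chain_def lookup_y)
  qed
  moreover have "Poly_Mapping.keys y \<subseteq> (SIGMA i:N. ?R i)"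
    by (auto simp: in_keys_iff lookup_y split: if_splits)
  ultimately have "y \<in> rgkc_feasible N D m zbar"
    by (simp add: rgkc_feasible_def)
  then show ?thesis
    by (rule bexI[rotated]) (simp add: lookup_y)
qed

lemma zhat_cost_le:
  assumes inst: "nlkc_instance N D m f" and feas: "zbar \<in> gkc_feasible N D m"
    and chain: "\<forall>i\<in>N. unit_chain 1 m (\<lambda>j. Poly_Mapping.lookup zbar (i, j))"
    and opt: "rgkc_optimal N D m f zbar zstar"
  shows "gkc_cost N m f (zhat N D m zbar zstar) \<le> 2 * gkc_cost N m f zbar"
proof -
  let ?a = "abar m zbar" and ?u = "mbar N D m zbar"
  let ?R = "\<lambda>i. {?a i + 1..?u i}"
  let ?b = "\<lambda>i j. Poly_Mapping.lookup zbar (i, j)"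
  let ?w = "\<lambda>i j. Poly_Mapping.lookup (zhat N D m zbar zstar) (i, j)"
  have fin: "finite N"
    using inst by (simp add: nlkc_instance_def)
  note lookup = lookup_zhat[OF fin, of D m zbar zstar]
  obtain y where y: "y \<in> rgkc_feasible N D m zbar"
    and y_eq: "\<And>i j. i \<in> N \<Longrightarrow> j \<in> ?R i \<Longrightarrow> Poly_Mapping.lookup y (i, j) = 2 * ?b i j"
    using double_residual_feasible[OF fin feas chain] by blast
  have zstar_nonneg: "0 \<le> Poly_Mapping.lookup zstar (i, j)" if "i \<in> N" "j \<in> ?R i" for i j
    using opt that by (auto simp: rgkc_optimal_def rgkc_feasible_def unit_chain_def)
  have g: "0 \<le> incr f i j" if "i \<in> N" "j \<in> {1..m}" for i j
    using incr_nonneg[OF inst] that by blast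
  have b_nonneg: "0 \<le> ?b i j" if "i \<in> N" "j \<in> {1..m}" for i j
    using chain that by (auto simp: unit_chain_def)
  have sub: "{1..?a i} \<union> ?R i \<subseteq> {1..m}" for i
    using abar_le[of m zbar i] mbar_le[of N D m zbar i] by auto
  have split: "(\<Sum>j\<in>{1..?a i} \<union> ?R i. h j) = (\<Sum>j = 1..?a i. h j) + (\<Sum>j\<in>?R i. h j)"
    for i and h :: "nat \<Rightarrow> ereal"
    by (intro sum.union_disjoint) auto
  have "gkc_cost N m f (zhat N D m zbar zstar) =
      (\<Sum>i\<in>N. \<Sum>j\<in>{1..?a i} \<union> ?R i. incr f i j * ereal (?w i j))"
    unfolding gkc_cost_def using sub
    by (intro sum.cong sum.mono_neutral_right) (auto simp: lookup)
  also have "\<dots> = (\<Sum>i\<in>N. \<Sum>j = 1..?a i. incr f i j * ereal (?w i j)) +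
      (\<Sum>i\<in>N. \<Sum>j\<in>?R i. incr f i j * ereal (?w i j))"
    by (simp only: split sum.distrib)
  \<comment> \<open>Up to \<open>abar\<close>, the entry 1 is at most \<open>2 * zbar\<close>; above
    it, \<open>zhat\<close> either agrees with \<open>zstar\<close> or has been set to 0.\<close>
  also have "\<dots> \<le> (\<Sum>i\<in>N. \<Sum>j = 1..?a i. incr f i j * ereal (2 * ?b i j)) + rgkc_cost N D m f zbar zstar"
    unfolding rgkc_cost_def
  proof (intro add_mono sum_mono ereal_mult_left_mono)
    show "ereal (?w i j) \<le> ereal (2 * ?b i j)" if "i \<in> N" "j \<in> {1..?a i}" for i j
      using half_le_below_abar[of m zbar i j] chain that by (simp add: lookup)
    show "ereal (?w i j) \<le> ereal (Poly_Mapping.lookup zstar (i, j))" if "i \<in> N" "j \<in> ?R i" for i j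
      using zstar_nonneg[OF that] that by (simp add: lookup)
  qed (use g sub in blast)+
  also have "\<dots> \<le> (\<Sum>i\<in>N. \<Sum>j = 1..?a i. incr f i j * ereal (2 * ?b i j)) + rgkc_cost N D m f zbar y"
    using opt y by (intro add_left_mono) (simp add: rgkc_optimal_def)
  also have "\<dots> = (\<Sum>i\<in>N. \<Sum>j\<in>{1..?a i} \<union> ?R i. incr f i j * ereal (2 * ?b i j))"
    by (simp only: split sum.distrib) (simp add: rgkc_cost_def y_eq)
  \<comment> \<open>The levels above \<open>mbar\<close> are added back at nonnegative cost.\<close>
  also have "\<dots> \<le> (\<Sum>i\<in>N. \<Sum>j = 1..m. incr f i j * ereal (2 * ?b i j))"
    using sub g b_nonneg by (intro sum_mono sum_mono2) auto
  also have "\<dots> = (\<Sum>i\<in>N. \<Sum>j = 1..m. 2 * (incr f i j * ereal (?b i j)))"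
    by (intro sum.cong refl) (simp add: mult.left_commute flip: times_ereal.simps(1))
  \<comment> \<open>Distributing 2 over sums in \<open>ereal\<close> uses that all terms are
    nonnegative.\<close>
  also have "\<dots> = 2 * gkc_cost N m f zbar"
    unfolding gkc_cost_def
    using g b_nonneg
    by (subst sum_ereal_right_distrib)
      (auto intro!: sum_nonneg sum.cong sum_ereal_right_distrib[symmetric])
  finally show ?thesis .
qed

theorem theorem2:
  fixes N :: "'i set" and D m :: nat and f :: "'i \<Rightarrow> nat \<Rightarrow> ereal"
    and zbar zstar :: "('i \<times> nat) \<Rightarrow>\<^sub>0 real"
  assumes "nlkc_instance N D m f"
    and "gkc_optimal N D m f zbar"
    and "\<forall>i\<in>N. unit_chain 1 m (\<lambda>j. Poly_Mapping.lookup zbar (i, j))"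
    and "rgkc_optimal N D m f zbar zstar"
    and "zstar extreme_point_of rgkc_feasible N D m zbar"
  shows "(\<exists>\<^sub>\<le>\<^sub>1 k. fractional_item N D m zbar zstar k) \<and>
    zhat N D m zbar zstar \<in> gkc_feasible N D m \<and>
    (\<forall>i\<in>N. \<forall>j\<in>{1..m}. Poly_Mapping.lookup (zhat N D m zbar zstar) (i, j) \<in> \<int>) \<and>
    gkc_cost N m f (zhat N D m zbar zstar) \<le> 2 * gkc_cost N m f zbar \<and>
    approx_solution 2 N D m f (zhat N D m zbar zstar)"
proof -
  let ?zhat = "zhat N D m zbar zstar"
  have fin: "finite N"
    using assms(1) by (simp add: nlkc_instance_def)
  obtain x where x: "x \<in> nlkc_feasible N D m" "corresponds N m x ?zhat"
    using zhat_corresponds_feasible[OF fin assms(5)] by blast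
  have cost: "gkc_cost N m f ?zhat \<le> 2 * gkc_cost N m f zbar"
    using zhat_cost_le[OF assms(1) _ assms(3,4)] assms(2) by (simp add: gkc_optimal_def)
  have C0: "0 \<le> (\<Sum>i\<in>N. f i 0)"
    by (intro sum_nonneg item_cost_nonneg[OF assms(1)]) auto
  \<comment> \<open>Any competing choice \<open>y\<close> gives a feasible vector of [GKC], whose
    cost is bounded below by that of \<open>zbar\<close>.\<close>
  have double: "nlkc_cost N f x \<le> 2 * nlkc_cost N f y" if y: "y \<in> nlkc_feasible N D m" for y
  proof -
    obtain z where z: "corresponds N m y z"
      using corresponds_exists[OF fin] by blast
    have "gkc_cost N m f zbar \<le> gkc_cost N m f z"
      using corresponds_gkc_feasible[OF fin y z] assms(2) by (simp add: gkc_optimal_def)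
    then have "gkc_cost N m f ?zhat \<le> 2 * gkc_cost N m f z"
      by (intro order_trans[OF cost] ereal_mult_left_mono) auto
    \<comment> \<open>The level-0 cost omitted by [GKC] is nonnegative, so restoring it on both
      sides keeps the factor 2.\<close>
    moreover have "(\<Sum>i\<in>N. f i 0) \<le> 2 * (\<Sum>i\<in>N. f i 0)"
      using C0 by (cases "\<Sum>i\<in>N. f i 0") auto
    ultimately have "(\<Sum>i\<in>N. f i 0) + gkc_cost N m f ?zhat \<le> 2 * ((\<Sum>i\<in>N. f i 0) + gkc_cost N m f z)"
      by (simp add: ereal_pos_distrib add_mono)
    then show ?thesis
      using corresponds_cost[OF assms(1) _ x(2)] corresponds_cost[OF assms(1) _ z] x(1) y
      by (simp add: nlkc_feasible_def)
  qed
  have "nlkc_cost N f x \<le> 2 * nlkc_opt N D m f"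
  proof -
    \<comment> \<open>Halving the left side leaves a plain infimum on the right, to which
      \<open>INF_greatest\<close> applies.\<close>
    have "nlkc_cost N f x / 2 \<le> nlkc_opt N D m f"
      unfolding nlkc_opt_def
      by (intro INF_greatest) (use double in \<open>simp add: ereal_divide_le_pos\<close>)
    then show ?thesis
      by (simp add: ereal_divide_le_pos)
  qed
  then have "approx_solution 2 N D m f ?zhat"
    using x by (auto simp: approx_solution_def)
  moreover have "?zhat \<in> gkc_feasible N D m"
    using corresponds_gkc_feasible[OF fin x] .
  moreover have "\<forall>i\<in>N. \<forall>j\<in>{1..m}. Poly_Mapping.lookup ?zhat (i, j) \<in> \<int>"
    using x(2) by (simp add: corresponds_def)
  moreover have "\<exists>\<^sub>\<le>\<^sub>1 k. fractional_item N D m zbar zstar k"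
    using fractional_item_unique[OF fin assms(5)] by (auto simp: Uniq_def)
  ultimately show ?thesis
    using cost by blast
qed

end
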